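(* There exist a reversible, irreducible, aperiodic Markov chain on a countable state space, with transition kernel $P$ and stationary probability distribution $\pi$, and a function $h\in L^1(\pi)\setminus L^2(\pi)$ with $\pi(h)=0$, such that, with $(X_n)_{n\ge0}$ the stationary chain and $r(x)=P(x,\{x\})$, $$\mathbb E_\pi\big[h(X_0)^2r(X_0)^n\big]<\infty\quad\text{for every }n\ge1,$$ $$n\,\mathbb E_\pi\big[h(X_0)^2r(X_0)^n\big]\longrightarrow\infty\quad(n\to\infty),$$ $$A=\infty,\qquad\gamma_1=-\infty;$$ consequently, $B$ is undefined since $\gamma_0=\pi(h^2)=\infty$.
   Context: Stationary means $X_0\sim\pi$; $\mathbb E_\pi,\operatorname{Var}_\pi$ are taken under $X_0\sim\pi$. $S_n=\sum_{k=0}^{n-1}h(X_k)$; $A=\lim_{n\to\infty}\frac1n\operatorname{Var}_\pi(S_n)$ (infinite values and limits allowed). $\gamma_k=\mathbb E_\pi[h(X_0)h(X_k)]$, allowed to be $\pm\infty$ (e.g. $\gamma_1=-\infty$ means the positive part of $h(X_0)h(X_1)$ is integrable and the negative part is not). $B=\lim_{m\to\infty}B_m$ with $B_m=\gamma_0+2\sum_{k=1}^m\gamma_k$; $B_m$ is undefined if the sum contains $\infty-\infty$. *)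

theory Defs
  imports "HOL-Probability.Probability"
begin

text \<open>
  A Markov kernel on the discrete state space \<^typ>\<open>'a\<close> is a function \<open>P :: 'a \<Rightarrow> 'a pmf\<close>,
  with \<open>P(x,{y}) = pmf (P x) y\<close>. The state space is all of \<^typ>\<open>'a\<close>, so irreducibility and
  aperiodicity quantify over every element of the type.
\<close>

primrec nstep :: "('a \<Rightarrow> 'a pmf) \<Rightarrow> nat \<Rightarrow> 'a \<Rightarrow> 'a pmf" where
  "nstep P 0 x = return_pmf x"
| "nstep P (Suc n) x = bind_pmf (nstep P n x) P"

definition irreducible_kernel :: "('a \<Rightarrow> 'a pmf) \<Rightarrow> bool" where
  "irreducible_kernel P \<longleftrightarrow> (\<forall>x y. \<exists>n. pmf (nstep P n x) y > 0)"

definition aperiodic_kernel :: "('a \<Rightarrow> 'a pmf) \<Rightarrow> bool" where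
  "aperiodic_kernel P \<longleftrightarrow> (\<forall>x. Gcd {n. n \<ge> 1 \<and> pmf (nstep P n x) x > 0} = (1::nat))"

definition stationary_dist :: "('a \<Rightarrow> 'a pmf) \<Rightarrow> 'a pmf \<Rightarrow> bool" where
  "stationary_dist P p \<longleftrightarrow> bind_pmf p P = p"

definition reversible_kernel :: "('a \<Rightarrow> 'a pmf) \<Rightarrow> 'a pmf \<Rightarrow> bool" where
  "reversible_kernel P p \<longleftrightarrow>
     (\<forall>x y. pmf p x * pmf (P x) y = pmf p y * pmf (P y) x)"

text \<open>
  The Markov property is stated multiplicatively, which avoids conditioning on null events.
\<close>

definition markov_chain ::
  "'w measure \<Rightarrow> (nat \<Rightarrow> 'w \<Rightarrow> 'a) \<Rightarrow> ('a \<Rightarrow> 'a pmf) \<Rightarrow> 'a pmf \<Rightarrow> bool" where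
  "markov_chain M X P p \<longleftrightarrow>
     prob_space M \<and>
     (\<forall>n. X n \<in> measurable M (count_space UNIV)) \<and>
     distr M (count_space UNIV) (X 0) = measure_pmf p \<and>
     (\<forall>n x. measure M {\<omega> \<in> space M. \<forall>i\<le>Suc n. X i \<omega> = x i} =
            measure M {\<omega> \<in> space M. \<forall>i\<le>n. X i \<omega> = x i} * pmf (P (x n)) (x (Suc n)))"

definition hold_prob :: "('a \<Rightarrow> 'a pmf) \<Rightarrow> 'a \<Rightarrow> real" where
  "hold_prob P x = pmf (P x) x"

definition partial_sum :: "(nat \<Rightarrow> 'w \<Rightarrow> 'a) \<Rightarrow> ('a \<Rightarrow> real) \<Rightarrow> nat \<Rightarrow> 'w \<Rightarrow> real" where
  "partial_sum X h n \<omega> = (\<Sum>k<n. h (X k \<omega>))"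

text \<open>
  The variance of an integrable random variable, with values in \<open>[0,\<infinity>]\<close>; unlike the library's
  real-valued variance, it is \<open>\<infinity>\<close> when there is no second moment.
\<close>

definition ext_variance :: "'w measure \<Rightarrow> ('w \<Rightarrow> real) \<Rightarrow> ennreal" where
  "ext_variance M Y = (\<integral>\<^sup>+ \<omega>. ennreal ((Y \<omega> - integral\<^sup>L M Y)\<^sup>2) \<partial>M)"

definition has_asymptotic_variance ::
  "'w measure \<Rightarrow> (nat \<Rightarrow> 'w \<Rightarrow> 'a) \<Rightarrow> ('a \<Rightarrow> real) \<Rightarrow> ennreal \<Rightarrow> bool" where
  "has_asymptotic_variance M X h a \<longleftrightarrow>
     (\<lambda>n. ext_variance M (partial_sum X h n) / of_nat n) \<longlonglongrightarrow> a"

text \<open>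
  The extended expectation is \<open>None\<close> when both the positive and the negative part have infinite
  integral. (\<^const>\<open>ennreal\<close> truncates negative reals to 0, so the two integrals below are those
  of the positive and negative part.) The guard is needed because \<open>\<infinity> - \<infinity> = \<infinity>\<close> on \<^typ>\<open>ereal\<close>.
\<close>

definition ext_expectation :: "'w measure \<Rightarrow> ('w \<Rightarrow> real) \<Rightarrow> ereal option" where
  "ext_expectation M f =
     (let p = (\<integral>\<^sup>+ \<omega>. ennreal (f \<omega>) \<partial>M); q = (\<integral>\<^sup>+ \<omega>. ennreal (- f \<omega>) \<partial>M)
      in if p = \<infinity> \<and> q = \<infinity> then None else Some (enn2ereal p - enn2ereal q))"

definition autocov ::
  "'w measure \<Rightarrow> (nat \<Rightarrow> 'w \<Rightarrow> 'a) \<Rightarrow> ('a \<Rightarrow> real) \<Rightarrow> nat \<Rightarrow> ereal option" where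
  "autocov M X h k = ext_expectation M (\<lambda>\<omega>. h (X 0 \<omega>) * h (X k \<omega>))"

text \<open>
  \<open>B\<^sub>m = \<gamma>\<^sub>0 + 2 (\<gamma>\<^sub>1 + \<dots> + \<gamma>\<^sub>m)\<close>, with \<open>None\<close> for ``undefined'': some term is undefined, or both
  \<open>\<infinity>\<close> and \<open>-\<infinity>\<close> occur among the terms.
\<close>

definition autocov_sum ::
  "'w measure \<Rightarrow> (nat \<Rightarrow> 'w \<Rightarrow> 'a) \<Rightarrow> ('a \<Rightarrow> real) \<Rightarrow> nat \<Rightarrow> ereal option" where
  "autocov_sum M X h m =
     (if (\<exists>k\<le>m. autocov M X h k = None) \<or>
         ((\<exists>k\<le>m. autocov M X h k = Some \<infinity>) \<and> (\<exists>k\<le>m. autocov M X h k = Some (-\<infinity>)))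
      then None
      else Some (the (autocov M X h 0) + 2 * (\<Sum>k=1..m. the (autocov M X h k))))"

definition has_autocov_series ::
  "'w measure \<Rightarrow> (nat \<Rightarrow> 'w \<Rightarrow> 'a) \<Rightarrow> ('a \<Rightarrow> real) \<Rightarrow> ereal \<Rightarrow> bool" where
  "has_autocov_series M X h b \<longleftrightarrow>
     (\<forall>\<^sub>F m in sequentially. autocov_sum M X h m \<noteq> None) \<and>
     (\<lambda>m. the (autocov_sum M X h m)) \<longlonglongrightarrow> b"

end

theory Submission
  imports Defs
begin

text \<open>
  At each step the chain tosses a coin whose bias \<open>d(x)\<close> depends on the current state \<open>x\<close>. On success
  it forgets everything and draws the next state from a fixed law \<open>\<nu>\<close> of full support; on failure it
  moves deterministically to \<open>\<sigma>(x)\<close>, where \<open>\<sigma>\<close> is an involution. If \<open>\<pi>\<close> and \<open>d\<close> are \<open>\<sigma>\<close>-invariant and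
  \<open>\<nu>\<close> is proportional to \<open>\<pi> d\<close>, the flow \<open>\<pi>(x) P(x,y)\<close> is a multiple of \<open>\<pi>(x) d(x) \<pi>(y) d(y)\<close> plus
  \<open>\<pi>(x) (1 - d(x))\<close> on the graph of \<open>\<sigma>\<close>, so it is symmetric in \<open>x\<close> and \<open>y\<close>: the chain is reversible
  (\<open>reversible_refresh_kernel\<close>). Every transition has positive probability, so the chain is also
  irreducible and aperiodic.

  The states come in pairs \<open>{2j, 2j + 1}\<close> on which \<open>h\<close> takes opposite values \<open>\<plusminus>a\<close> and \<open>\<pi>\<close> is constant,
  which gives \<open>\<pi>(h) = 0\<close>. There are two kinds of pairs.

  \<^item> Switching pairs (\<open>j\<close> even): \<open>a = 2\<^sup>j\<close>, \<open>\<pi>\<close> proportional to \<open>4\<^sup>-\<^sup>j\<close>, \<open>d = 1/2\<close>, and \<open>\<sigma>\<close> exchanges the two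
    states. Here \<open>\<pi> h\<^sup>2\<close> is constant, so \<open>\<pi>(h\<^sup>2) = \<infinity>\<close>, while \<open>\<pi> \<bar>h\<bar>\<close> is summable. With probability at
    least 1/2 the chain steps from \<open>h = a\<close> to \<open>h = -a\<close>, which makes the negative part of \<open>h(X\<^sub>0) h(X\<^sub>1)\<close>
    non-integrable. A switching state can be held only through a refresh, so its holding
    probability is at most \<open>\<nu>(x)\<close> and \<open>\<pi> h\<^sup>2 r\<close> is summable.

  \<^item> Holding pairs (\<open>j\<close> odd): \<open>a = 1\<close>, \<open>\<pi>\<close> proportional to \<open>2\<^sup>-\<^sup>j\<close>, \<open>d = 4\<^sup>-\<^sup>j\<close>, and \<open>\<sigma>\<close> is the identity. The
    pair with \<open>4\<^sup>j\<close> of order \<open>n\<close> has \<open>r\<^sup>n\<close> bounded below and mass of order \<open>1/sqrt n\<close>, so it alone makes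
    \<open>n \<pi>(h\<^sup>2 r\<^sup>n)\<close> grow at least like \<open>sqrt n\<close> (\<open>nn_integral_hold_lower_bound\<close>).

  The positive part of \<open>h(X\<^sub>0) h(X\<^sub>1)\<close> is integrable: after a refresh it is controlled by
  \<open>\<pi>(\<bar>h\<bar>) \<nu>(\<bar>h\<bar>)\<close>, and without one it is at most 1 (\<open>nn_integral_positive_product_finite\<close>). Together
  with the previous remarks, \<open>\<gamma>\<^sub>1 = -\<infinity>\<close> and \<open>\<gamma>\<^sub>0 = \<infinity>\<close>.

  Finally \<open>Var(S\<^sub>n)\<close> is already infinite for each \<open>n \<ge> 1\<close>. The trajectory that starts at a switching
  state \<open>x\<close>, refreshes to the state 0 and stays there has probability at least a constant multiple of
  \<open>\<pi>(x)\<close>, and along it \<open>S\<^sub>n\<close> differs from \<open>h(x)\<close> by a constant; so the cancellation between the two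
  states of a pair does not help (\<open>ext_variance_partial_sum\<close>).

  All the infinite integrals are obtained in the same way, from infinitely many disjoint events that
  each contribute at least a fixed positive amount (\<open>nn_integral_markov_eq_top\<close>).
\<close>

section \<open>The path measure of a Markov kernel\<close>

text \<open>
  The coordinate process on path space is a Markov chain with kernel \<open>P\<close> and initial law \<open>p\<close>. The
  measure comes from the Ionescu-Tulcea theorem, whose kernels may look at the whole past; here they
  look at the last coordinate only. Countability of the state space makes point masses determine a law.
\<close>

locale chain_construction =
  fixes P :: "'a::countable \<Rightarrow> 'a pmf" and p :: "'a pmf"
begin

fun step :: "nat \<Rightarrow> (nat \<Rightarrow> 'a) \<Rightarrow> 'a measure" where
  "step 0 \<omega> = measure_pmf p"
| "step (Suc n) \<omega> = measure_pmf (P (\<omega> n))"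

sublocale IT: Ionescu_Tulcea step "\<lambda>_. count_space UNIV"
proof (rule Ionescu_Tulcea.intro)
  fix i :: nat
  show "step i \<in> measurable (PiM {0..<i} (\<lambda>_. count_space UNIV)) (subprob_algebra (count_space UNIV))"
  proof (cases i)
    case 0
    then have "step i = (\<lambda>_. measure_pmf p)" by auto
    then show ?thesis by (simp add: measure_pmf_in_subprob_algebra)
  next
    case (Suc n)
    then have "step i = (\<lambda>\<omega>. measure_pmf (P (\<omega> n)))" by auto
    moreover have "(\<lambda>\<omega>. \<omega> n) \<in> measurable (PiM {0..<i} (\<lambda>_. count_space UNIV)) (count_space (UNIV :: 'a set))"
      using Suc by (intro measurable_component_singleton) auto
    moreover have "(\<lambda>x. measure_pmf (P x)) \<in> measurable (count_space UNIV) (subprob_algebra (count_space UNIV))"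
      by (simp add: measure_pmf_in_subprob_algebra)
    ultimately show ?thesis by (simp add: measurable_compose[of _ _ "count_space UNIV"])
  qed
next
  fix i :: nat and x :: "nat \<Rightarrow> 'a"
  show "prob_space (step i x)"
    by (cases i) (auto intro: prob_space_measure_pmf)
qed

definition path_space :: "(nat \<Rightarrow> 'a) measure" where
  "path_space = IT.PF.lim"

lemma sets_path_space: "sets path_space = sets (PiM UNIV (\<lambda>_. count_space UNIV))"
  by (simp add: path_space_def)

lemma space_path_space: "space path_space = UNIV"
  by (subst sets_eq_imp_space_eq[OF sets_path_space]) (simp add: space_PiM)

definition cyl :: "(nat \<Rightarrow> 'a) \<Rightarrow> nat \<Rightarrow> (nat \<Rightarrow> 'a) set" where
  "cyl x n = PiE {0..<n} (\<lambda>i. {x i})"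

lemma sets_cyl [measurable]: "cyl x n \<in> sets (PiM {0..<n} (\<lambda>_. count_space UNIV))"
  unfolding cyl_def by (intro sets_PiM_I_finite) auto

text \<open>
  Prolonging a trajectory by one step multiplies its probability by the transition probability: on
  the cylinder the kernel \<open>step n\<close> sees exactly the past \<open>x\<close>.
\<close>

lemma C_cyl_Suc:
  "emeasure (IT.C 0 (Suc n) (\<lambda>_. undefined)) (cyl x (Suc n)) =
   emeasure (IT.C 0 n (\<lambda>_. undefined)) (cyl x n) * emeasure (step n x) {x n}"
proof -
  let ?C = "IT.C 0 n (\<lambda>_. undefined)" and ?M = "\<lambda>n. PiM {0..<n} (\<lambda>_. count_space (UNIV :: 'a set))"
  have u: "(\<lambda>_. undefined) \<in> space (?M 0)" by (auto simp: space_PiM)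
  have sp: "space ?C = space (?M n)" and st: "sets ?C = sets (?M n)"
    using IT.space_C[OF u, of n] IT.sets_C[OF u, of n] by (auto simp: space_PiM)
  have "emeasure (IT.C 0 (Suc n) (\<lambda>_. undefined)) (cyl x (Suc n)) =
      (\<integral>\<^sup>+\<omega>. emeasure (IT.eP n \<omega>) (cyl x (Suc n)) \<partial>?C)"
    using st sp by (simp, subst emeasure_bind[where N="?M (Suc n)"])
       (auto simp: space_PiM cong: measurable_cong_sets intro: IT.measurable_eP)
  also have "\<dots> = (\<integral>\<^sup>+\<omega>. emeasure (step n x) {x n} * indicator (cyl x n) \<omega> \<partial>?C)"
  proof (rule nn_integral_cong)
    fix \<omega> assume "\<omega> \<in> space ?C"
    then have w: "\<omega> \<in> space (?M n)" by (simp add: sp)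
    have "emeasure (IT.eP n \<omega>) (cyl x (Suc n)) = emeasure (step n \<omega>) (fun_upd \<omega> n -` cyl x (Suc n) \<inter> space (count_space UNIV))"
      by (rule IT.emeasure_eP[OF w sets_cyl])
    also have "fun_upd \<omega> n -` cyl x (Suc n) = (if \<omega> \<in> cyl x n then {x n} else {})"
    proof -
      have "fun_upd \<omega> n y \<in> cyl x (Suc n) \<longleftrightarrow> \<omega> \<in> cyl x n \<and> y = x n" for y
        using w by (auto simp: cyl_def PiE_iff space_PiM extensional_def split: if_splits)
      then show ?thesis by auto
    qed
    also have "emeasure (step n \<omega>) ((if \<omega> \<in> cyl x n then {x n} else {}) \<inter> space (count_space UNIV))
        = emeasure (step n x) {x n} * indicator (cyl x n) \<omega>"
      by (cases n) (auto simp: cyl_def PiE_iff)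
    finally show "emeasure (IT.eP n \<omega>) (cyl x (Suc n)) = \<dots>" .
  qed
  also have "\<dots> = emeasure (step n x) {x n} * emeasure ?C (cyl x n)"
    by (rule nn_integral_cmult_indicator) (simp add: st)
  finally show ?thesis by (simp add: mult.commute)
qed

lemma emeasure_path_space:
  "emeasure path_space {\<omega>. \<forall>i<n. \<omega> i = x i} = emeasure (IT.C 0 n (\<lambda>_. undefined)) (cyl x n)"
proof -
  have "{\<omega>. \<forall>i<n. \<omega> i = x i} = IT.PF.emb UNIV {0..<n} (cyl x n)"
    by (auto simp: prod_emb_def cyl_def PiE_iff)
  then have "emeasure path_space {\<omega>. \<forall>i<n. \<omega> i = x i} = emeasure (IT.CI {0..<n}) (cyl x n)"
    unfolding path_space_def by (simp add: IT.lim)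
  also have "\<dots> = emeasure (IT.C 0 n (\<lambda>_. undefined)) (IT.PF.emb {0..<n} {0..<n} (cyl x n))"
    by (intro IT.emeasure_CI) auto
  also have "IT.PF.emb {0..<n} {0..<n} (cyl x n) = cyl x n"
    by (auto simp: prod_emb_def cyl_def PiE_iff extensional_restrict)
  finally show ?thesis .
qed

lemma markov_chain_path_space: "markov_chain path_space (\<lambda>n \<omega>. \<omega> n) P p"
proof -
  let ?X = "\<lambda>n (\<omega> :: nat \<Rightarrow> 'a). \<omega> n"
  have X: "?X n \<in> measurable path_space (count_space UNIV)" for n
    by (subst measurable_cong_sets[OF sets_path_space refl])
       (rule measurable_component_singleton, simp)
  have "emeasure path_space UNIV = emeasure path_space {\<omega>. \<forall>i<0. \<omega> i = undefined i}" by simp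
  also have "\<dots> = 1"
    unfolding emeasure_path_space using sets_cyl[of undefined 0]
    by (simp add: cyl_def emeasure_return)
  finally have ps: "prob_space path_space"
    by (intro prob_spaceI) (simp add: space_path_space)
  have step1: "emeasure path_space {\<omega>. \<forall>i<Suc n. \<omega> i = x i} =
     emeasure path_space {\<omega>. \<forall>i<n. \<omega> i = x i} * emeasure (step n x) {x n}" for n x
    by (simp only: emeasure_path_space C_cyl_Suc)
  have X0: "distr path_space (count_space UNIV) (?X 0) = measure_pmf p"
  proof (rule measure_eqI_countable[where A=UNIV])
    fix a :: 'a
    have e0: "emeasure path_space {\<omega>. \<forall>i<Suc 0. \<omega> i = a} = emeasure (measure_pmf p) {a}"
      using step1[of 0 "\<lambda>_. a"] prob_space.emeasure_space_1[OF ps] by (simp add: space_path_space)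
    have "emeasure (distr path_space (count_space UNIV) (?X 0)) {a} =
        emeasure path_space (?X 0 -` {a} \<inter> space path_space)"
      by (rule emeasure_distr[OF X]) simp
    also have "?X 0 -` {a} \<inter> space path_space = {\<omega>. \<forall>i<Suc 0. \<omega> i = a}"
      by (auto simp: space_path_space)
    finally show "emeasure (distr path_space (count_space UNIV) (?X 0)) {a} = emeasure (measure_pmf p) {a}"
      by (simp only: e0)
  qed auto
  have "measure path_space {\<omega> \<in> space path_space. \<forall>i\<le>Suc n. \<omega> i = x i} =
        measure path_space {\<omega> \<in> space path_space. \<forall>i\<le>n. \<omega> i = x i} * pmf (P (x n)) (x (Suc n))" for n x
    using step1[of "Suc n" x]
    by (simp add: measure_def space_path_space enn2real_mult emeasure_pmf_single less_Suc_eq_le)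
  then show ?thesis
    unfolding markov_chain_def using ps X X0 by blast
qed

end

section \<open>Integrals along a Markov chain\<close>

text \<open>
  For every finite set of \<open>n\<close> indices the integral dominates the sum of the corresponding \<open>n\<close>
  contributions, hence \<open>n c\<close>. Disjointness bounds the
  sum of the step functions \<open>v x\<close> on \<open>E x\<close> by \<open>F\<close> pointwise.
\<close>

lemma nn_integral_eq_top_disjoint_events:
  fixes F :: "'w \<Rightarrow> ennreal" and v :: "'s \<Rightarrow> ennreal"
  assumes "infinite S" and "c > 0"
    and E: "\<And>x. x \<in> S \<Longrightarrow> E x \<in> sets M" and disj: "disjoint_family_on E S"
    and v: "\<And>x \<omega>. x \<in> S \<Longrightarrow> \<omega> \<in> E x \<Longrightarrow> v x \<le> F \<omega>"
    and c: "\<And>x. x \<in> S \<Longrightarrow> c \<le> v x * emeasure M (E x)"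
  shows "(\<integral>\<^sup>+\<omega>. F \<omega> \<partial>M) = \<infinity>"
proof -
  have bound: "of_nat n * c \<le> (\<integral>\<^sup>+\<omega>. F \<omega> \<partial>M)" for n
  proof -
    obtain T where T: "finite T" "card T = n" "T \<subseteq> S"
      using infinite_arbitrarily_large[OF \<open>infinite S\<close>] by blast
    have "of_nat n * c = (\<Sum>x\<in>T. c)" by (simp add: T)
    also have "\<dots> \<le> (\<Sum>x\<in>T. v x * emeasure M (E x))"
      using T by (intro sum_mono c) auto
    also have "\<dots> = (\<Sum>x\<in>T. \<integral>\<^sup>+\<omega>. v x * indicator (E x) \<omega> \<partial>M)"
      using T E by (intro sum.cong refl nn_integral_cmult_indicator[symmetric]) auto
    also have "\<dots> = (\<integral>\<^sup>+\<omega>. (\<Sum>x\<in>T. v x * indicator (E x) \<omega>) \<partial>M)"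
      using T E by (intro nn_integral_sum[symmetric]) auto
    also have "\<dots> \<le> (\<integral>\<^sup>+\<omega>. F \<omega> \<partial>M)"
    proof (rule nn_integral_mono)
      fix \<omega>
      show "(\<Sum>x\<in>T. v x * indicator (E x) \<omega>) \<le> F \<omega>"
      proof (cases "\<exists>x\<in>T. \<omega> \<in> E x")
        case True
        then obtain x where x: "x \<in> T" "\<omega> \<in> E x" by blast
        then have "\<omega> \<notin> E y" if "y \<in> T" "y \<noteq> x" for y
          using disj T(3) that by (auto simp: disjoint_family_on_def)
        then have "(\<Sum>y\<in>T. v y * indicator (E y) \<omega>) = (\<Sum>y\<in>T. if y = x then v x else 0)"
          using x by (intro sum.cong) (auto simp: indicator_def)
        with x T v[of x \<omega>] show ?thesis by auto
      qed (simp add: indicator_def)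
    qed
    finally show ?thesis .
  qed
  show ?thesis
  proof (rule ccontr)
    assume "(\<integral>\<^sup>+\<omega>. F \<omega> \<partial>M) \<noteq> \<infinity>"
    then have fin: "(\<integral>\<^sup>+\<omega>. F \<omega> \<partial>M) < top" by (simp add: top.not_eq_extremum)
    moreover have "c < top"
      using bound[of 1] fin by (simp add: order.strict_trans1)
    ultimately obtain r c' where r: "(\<integral>\<^sup>+\<omega>. F \<omega> \<partial>M) = ennreal r" "c = ennreal c'" "0 \<le> r" "0 < c'"
      using \<open>c > 0\<close> by (metis ennreal_cases ennreal_less_zero_iff less_irrefl infinity_ennreal_def)
    obtain n where "r < real n * c'"
      using reals_Archimedean3[OF \<open>0 < c'\<close>] by blast
    then have "(\<integral>\<^sup>+\<omega>. F \<omega> \<partial>M) < of_nat n * c"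
      using r by (simp add: ennreal_of_nat_eq_real_of_nat ennreal_mult[symmetric] ennreal_less_iff)
    then show False
      using bound[of n] by simp
  qed
qed

lemma markov_chain_path_prob:
  assumes "markov_chain M X P p"
  shows "measure M {\<omega> \<in> space M. \<forall>i\<le>n. X i \<omega> = x i} =
    pmf p (x 0) * (\<Prod>i<n. pmf (P (x i)) (x (Suc i)))"
proof (induction n)
  case 0
  have "pmf p (x 0) = measure (distr M (count_space UNIV) (X 0)) {x 0}"
    using assms by (simp add: markov_chain_def measure_pmf_single)
  also have "\<dots> = measure M {\<omega> \<in> space M. X 0 \<omega> = x 0}"
    using assms by (subst measure_distr) (auto simp: markov_chain_def vimage_def Int_def conj_commute)
  finally show ?case by simp
next
  case (Suc n)
  then show ?case using assms by (simp add: markov_chain_def mult.assoc)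
qed

lemma nn_integral_markov_start:
  assumes "markov_chain M X P p"
  shows "(\<integral>\<^sup>+\<omega>. f (X 0 \<omega>) \<partial>M) = (\<integral>\<^sup>+x. f x \<partial>p)"
proof -
  have "(\<integral>\<^sup>+x. f x \<partial>p) = (\<integral>\<^sup>+x. f x \<partial>distr M (count_space UNIV) (X 0))"
    using assms by (simp add: markov_chain_def)
  also have "\<dots> = (\<integral>\<^sup>+\<omega>. f (X 0 \<omega>) \<partial>M)"
    using assms by (intro nn_integral_distr) (auto simp: markov_chain_def)
  finally show ?thesis ..
qed

text \<open>
  The pair \<open>(X\<^sub>0, X\<^sub>1)\<close> has the law obtained by drawing \<open>x\<close> from \<open>p\<close> and then \<open>y\<close> from \<open>P x\<close>; on a
  countable space it suffices to compare point masses.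
\<close>

lemma nn_integral_markov_step:
  fixes X :: "nat \<Rightarrow> 'w \<Rightarrow> 'a::countable"
  assumes mc: "markov_chain M X P p"
  shows "(\<integral>\<^sup>+\<omega>. F (X 0 \<omega>) (X 1 \<omega>) \<partial>M) = (\<integral>\<^sup>+x. \<integral>\<^sup>+y. F x y \<partial>P x \<partial>p)"
proof -
  interpret prob_space M using mc by (simp add: markov_chain_def)
  have X[measurable]: "X n \<in> measurable M (count_space UNIV)" for n
    using mc by (simp add: markov_chain_def)
  define J where "J = bind_pmf p (\<lambda>x. map_pmf (Pair x) (P x))"
  have XX[measurable]: "(\<lambda>\<omega>. (X 0 \<omega>, X 1 \<omega>)) \<in> measurable M (count_space UNIV)"
    by measurable
  have "distr M (count_space UNIV) (\<lambda>\<omega>. (X 0 \<omega>, X 1 \<omega>)) = measure_pmf J"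
  proof (rule measure_eqI_countable[where A=UNIV])
    fix z :: "'a \<times> 'a"
    obtain x y where z: "z = (x, y)" by (cases z)
    have "{\<omega> \<in> space M. (X 0 \<omega>, X 1 \<omega>) = z} =
        {\<omega> \<in> space M. \<forall>i\<le>1. X i \<omega> = (\<lambda>i. if i = 0 then x else y) i}"
      by (auto simp: z le_Suc_eq)
    then have "prob {\<omega> \<in> space M. (X 0 \<omega>, X 1 \<omega>) = z} = pmf p x * pmf (P x) y"
      using markov_chain_path_prob[OF mc, of 1 "\<lambda>i. if i = 0 then x else y"] by simp
    moreover have "emeasure J {z} = ennreal (pmf p x * pmf (P x) y)"
    proof -
      have "emeasure J {z} = (\<integral>\<^sup>+x'. \<integral>\<^sup>+y'. indicator {(x, y)} (x', y') \<partial>P x' \<partial>p)"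
        by (subst nn_integral_indicator[symmetric]) (simp_all add: J_def z del: nn_integral_indicator)
      also have "\<dots> = (\<integral>\<^sup>+x'. emeasure (P x) {y} * indicator {x} x' \<partial>p)"
        by (intro nn_integral_cong) (auto simp: indicator_def nn_integral_indicator[symmetric] simp del: nn_integral_indicator intro!: nn_integral_cong)
      also have "\<dots> = ennreal (pmf p x * pmf (P x) y)"
        by (simp add: nn_integral_cmult_indicator emeasure_pmf_single ennreal_mult' mult.commute)
      finally show ?thesis .
    qed
    ultimately show "emeasure (distr M (count_space UNIV) (\<lambda>\<omega>. (X 0 \<omega>, X 1 \<omega>))) {z} = emeasure J {z}"
      by (simp add: emeasure_distr emeasure_eq_measure vimage_def Int_def conj_commute)
  qed auto
  then have "(\<integral>\<^sup>+z. case_prod F z \<partial>J) = (\<integral>\<^sup>+z. case_prod F z \<partial>distr M (count_space UNIV) (\<lambda>\<omega>. (X 0 \<omega>, X 1 \<omega>)))"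
    by simp
  also have "\<dots> = (\<integral>\<^sup>+\<omega>. F (X 0 \<omega>) (X 1 \<omega>) \<partial>M)"
    by (subst nn_integral_distr) auto
  finally show ?thesis by (simp add: J_def)
qed

text \<open>
  The form of the divergence criterion used for \<open>\<gamma>\<^sub>0\<close>, \<open>\<gamma>\<^sub>1\<close> and \<open>Var(S\<^sub>n)\<close>: the event attached to a state
  \<open>x\<close> is that the chain follows a prescribed trajectory \<open>traj x\<close> for \<open>n\<close> steps. Trajectories with
  different starting points give disjoint events.
\<close>

lemma nn_integral_markov_eq_top:
  fixes c :: real and v :: "'a \<Rightarrow> real"
  assumes mc: "markov_chain M X P p" and "infinite S" and "c > 0"
    and traj0: "\<And>x. traj x 0 = x"
    and F: "\<And>x \<omega>. x \<in> S \<Longrightarrow> (\<And>i. i \<le> n \<Longrightarrow> X i \<omega> = traj x i) \<Longrightarrow> v x \<le> F \<omega>"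
    and v: "\<And>x. x \<in> S \<Longrightarrow> 0 \<le> v x"
    and c: "\<And>x. x \<in> S \<Longrightarrow> c \<le> v x * (pmf p x * (\<Prod>i<n. pmf (P (traj x i)) (traj x (Suc i))))"
  shows "(\<integral>\<^sup>+\<omega>. ennreal (F \<omega>) \<partial>M) = \<infinity>"
proof (rule nn_integral_eq_top_disjoint_events[OF \<open>infinite S\<close>, where c = "ennreal c" and v = "\<lambda>x. ennreal (v x)"
      and E = "\<lambda>x. {\<omega> \<in> space M. \<forall>i\<le>n. X i \<omega> = traj x i}"])
  interpret prob_space M using mc by (simp add: markov_chain_def)
  have X[measurable]: "X n \<in> measurable M (count_space UNIV)" for n
    using mc by (simp add: markov_chain_def)
  show "ennreal c > 0" using \<open>c > 0\<close> by simp
  show "disjoint_family_on (\<lambda>x. {\<omega> \<in> space M. \<forall>i\<le>n. X i \<omega> = traj x i}) S"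
    using traj0 by (auto simp: disjoint_family_on_def dest!: spec[where x=0])
  fix x assume x: "x \<in> S"
  show "{\<omega> \<in> space M. \<forall>i\<le>n. X i \<omega> = traj x i} \<in> sets M" by measurable
  show "ennreal (v x) \<le> ennreal (F \<omega>)" if "\<omega> \<in> {\<omega> \<in> space M. \<forall>i\<le>n. X i \<omega> = traj x i}" for \<omega>
    using F[OF x, of \<omega>] that by (auto intro: ennreal_leI)
  show "ennreal c \<le> ennreal (v x) * emeasure M {\<omega> \<in> space M. \<forall>i\<le>n. X i \<omega> = traj x i}"
    using c[OF x] v[OF x] markov_chain_path_prob[OF mc, of n "traj x"]
    by (simp add: emeasure_eq_measure ennreal_mult[symmetric] traj0 ennreal_leI prod_nonneg)
qed

section \<open>Reversible kernels that refresh or follow an involution\<close>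

lemma reversible_imp_stationary:
  assumes "reversible_kernel P p"
  shows "stationary_dist P p"
  unfolding stationary_dist_def
proof (rule pmf_eqI)
  fix y
  have "ennreal (pmf (bind_pmf p P) y) = (\<integral>\<^sup>+x. pmf p x * pmf (P x) y \<partial>count_space UNIV)"
    by (simp add: ennreal_pmf_bind nn_integral_measure_pmf ennreal_mult')
  also have "\<dots> = (\<integral>\<^sup>+x. ennreal (pmf p y) * ennreal (pmf (P y) x) \<partial>count_space UNIV)"
    using assms unfolding reversible_kernel_def
    by (intro nn_integral_cong) (metis ennreal_mult' pmf_nonneg)
  also have "\<dots> = ennreal (pmf p y)"
    by (simp add: nn_integral_cmult nn_integral_pmf_eq_1)
  finally show "pmf (bind_pmf p P) y = pmf p y" by simp
qed

lemma positive_kernel_irreducible_aperiodic: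
  assumes "\<And>x y. pmf (P x) y > 0"
  shows "irreducible_kernel P" "aperiodic_kernel P"
proof -
  have step: "nstep P 1 x = P x" for x by (simp add: bind_return_pmf)
  show "irreducible_kernel P"
    unfolding irreducible_kernel_def using assms step by metis
  have "Gcd {n. n \<ge> 1 \<and> pmf (nstep P n x) x > 0} dvd 1" for x
    by (rule Gcd_dvd) (use assms step in auto)
  then show "aperiodic_kernel P"
    unfolding aperiodic_kernel_def by simp
qed

definition refresh_kernel :: "('a \<Rightarrow> real) \<Rightarrow> 'a pmf \<Rightarrow> ('a \<Rightarrow> 'a) \<Rightarrow> 'a \<Rightarrow> 'a pmf" where
  "refresh_kernel d \<nu> \<sigma> x = bind_pmf (bernoulli_pmf (d x)) (\<lambda>b. if b then \<nu> else return_pmf (\<sigma> x))"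

lemma pmf_refresh_kernel:
  assumes "0 \<le> d x" "d x \<le> 1"
  shows "pmf (refresh_kernel d \<nu> \<sigma> x) y = d x * pmf \<nu> y + (if \<sigma> x = y then 1 - d x else 0)"
  using assms by (simp add: refresh_kernel_def pmf_bind indicator_def algebra_simps)

lemma nn_integral_refresh_kernel:
  assumes "0 \<le> d x" "d x \<le> 1"
  shows "(\<integral>\<^sup>+y. f y \<partial>refresh_kernel d \<nu> \<sigma> x) = (\<integral>\<^sup>+y. f y \<partial>\<nu>) * d x + f (\<sigma> x) * (1 - d x)"
  using assms by (simp add: refresh_kernel_def nn_integral_return)

text \<open>
  Substituting \<open>\<nu>\<close>, the refresh part of the flow from \<open>x\<close> to \<open>y\<close> is \<open>K p(x) d(x) p(y) d(y)\<close>. The other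
  part is carried by the pairs \<open>(x, \<sigma> x)\<close>, a symmetric relation because \<open>\<sigma>\<close> is an involution, and its
  value is the same at both ends because \<open>p\<close> and \<open>d\<close> are \<open>\<sigma>\<close>-invariant.
\<close>

lemma reversible_refresh_kernel:
  assumes d: "\<And>x. 0 \<le> d x" "\<And>x. d x \<le> 1"
    and inv: "\<And>x. \<sigma> (\<sigma> x) = x" "\<And>x. d (\<sigma> x) = d x" "\<And>x. pmf p (\<sigma> x) = pmf p x"
    and \<nu>: "\<And>x. pmf \<nu> x = K * (pmf p x * d x)"
  shows "reversible_kernel (refresh_kernel d \<nu> \<sigma>) p"
  unfolding reversible_kernel_def
proof (intro allI)
  fix x y
  have "\<sigma> x = y \<longleftrightarrow> \<sigma> y = x" using inv(1) by metis
  then show "pmf p x * pmf (refresh_kernel d \<nu> \<sigma> x) y = pmf p y * pmf (refresh_kernel d \<nu> \<sigma> y) x"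
    using inv(2,3)[of x] d by (auto simp: pmf_refresh_kernel \<nu> algebra_simps)
qed

definition weight_pmf :: "(nat \<Rightarrow> real) \<Rightarrow> nat pmf" where
  "weight_pmf w = embed_pmf (\<lambda>x. w x / suminf w)"

lemma pmf_weight_pmf:
  assumes w: "\<And>x. w x > 0" and "summable w"
  shows "pmf (weight_pmf w) x = w x / suminf w"
proof -
  have pos: "suminf w > 0" using assms by (rule suminf_pos[rotated])
  show ?thesis
    unfolding weight_pmf_def
  proof (rule pmf_embed_pmf)
    have "(\<integral>\<^sup>+x. ennreal (w x / suminf w) \<partial>count_space UNIV) = (\<Sum>x. ennreal (w x / suminf w))"
      by (rule nn_integral_count_space_nat)
    also have "\<dots> = ennreal (\<Sum>x. w x / suminf w)"
      using assms pos by (intro suminf_ennreal2 summable_divide) (auto intro: less_imp_le)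
    also have "(\<Sum>x. w x / suminf w) = 1"
      using suminf_divide[OF \<open>summable w\<close>, of "suminf w"] pos by simp
    finally show "(\<integral>\<^sup>+x. ennreal (w x / suminf w) \<partial>count_space UNIV) = 1" by simp
  qed (use w pos in \<open>auto intro: less_imp_le\<close>)
qed

lemma nn_integral_pmf_nat_finite:
  fixes p :: "nat pmf"
  assumes f: "\<And>x. 0 \<le> f x" and g: "summable g" and le: "\<And>x. pmf p x * f x \<le> g x"
  shows "(\<integral>\<^sup>+x. ennreal (f x) \<partial>p) < \<infinity>"
proof -
  have sm: "summable (\<lambda>x. pmf p x * f x)"
    by (rule summable_comparison_test_ev[OF _ g]) (use f le in auto)
  have "(\<integral>\<^sup>+x. ennreal (f x) \<partial>p) = (\<Sum>x. ennreal (pmf p x * f x))"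
    using f by (simp add: nn_integral_measure_pmf nn_integral_count_space_nat ennreal_mult')
  also have "\<dots> = ennreal (\<Sum>x. pmf p x * f x)"
    using f sm by (intro suminf_ennreal2) auto
  finally show ?thesis by simp
qed

section \<open>The chain and the observable\<close>

text \<open>
  The pair of \<open>x\<close> is \<open>x div 2\<close>; it is switching if this number is even and holding if it is odd. The
  exponents are balanced so that on switching pairs weight times squared amplitude is 1, while on all
  pairs weight times amplitude is \<open>(1/2)\<^sup>j\<close>.
\<close>

definition pair_weight :: "nat \<Rightarrow> real" where
  "pair_weight x = (let j = x div 2 in if even j then (1/4)^j else (1/2)^j)"
definition refresh_prob :: "nat \<Rightarrow> real" where
  "refresh_prob x = (let j = x div 2 in if even j then 1/2 else (1/4)^j)"
definition amplitude :: "nat \<Rightarrow> real" where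
  "amplitude x = (let j = x div 2 in if even j then 2^j else 1)"
definition observable :: "nat \<Rightarrow> real" where
  "observable x = (if even x then amplitude x else - amplitude x)"
definition partner :: "nat \<Rightarrow> nat" where
  "partner x = (if even x then Suc x else x - 1)"
definition switch :: "nat \<Rightarrow> nat" where
  "switch x = (if even (x div 2) then partner x else x)"

definition stat_law :: "nat pmf" where "stat_law = weight_pmf pair_weight"
definition refresh_law :: "nat pmf" where
  "refresh_law = weight_pmf (\<lambda>x. pair_weight x * refresh_prob x)"
definition chain_kernel :: "nat \<Rightarrow> nat pmf" where
  "chain_kernel = refresh_kernel refresh_prob refresh_law switch"

lemma partner_div2 [simp]: "partner x div 2 = x div 2"
  and even_partner [simp]: "even (partner x) \<longleftrightarrow> odd x"
  and partner_partner [simp]: "partner (partner x) = x"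
  by (auto simp: partner_def elim!: oddE)

lemma partner_neq [simp]: "partner x \<noteq> x"
  using even_partner[of x] by metis

lemma partner_invariant [simp]:
  "pair_weight (partner x) = pair_weight x" "refresh_prob (partner x) = refresh_prob x"
  "amplitude (partner x) = amplitude x" "observable (partner x) = - observable x"
  by (simp_all add: pair_weight_def refresh_prob_def amplitude_def observable_def)

lemma switch_switch [simp]: "switch (switch x) = x"
  by (simp add: switch_def)

lemma switch_invariant [simp]:
  "pair_weight (switch x) = pair_weight x" "refresh_prob (switch x) = refresh_prob x"
  by (simp_all add: switch_def)

lemma pair_weight_pos: "pair_weight x > 0"
  by (simp add: pair_weight_def Let_def)
lemma refresh_prob_pos: "refresh_prob x > 0"
  by (simp add: refresh_prob_def Let_def)
lemma refresh_prob_le_1: "refresh_prob x \<le> 1"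
  by (simp add: refresh_prob_def Let_def power_le_one)

lemma abs_observable: "\<bar>observable x\<bar> = amplitude x"
  by (simp add: observable_def amplitude_def Let_def)

text \<open>
  The convergence of every series below rests on this one, whose terms are constant on pairs.
\<close>

lemma summable_half_div2: "summable (\<lambda>x::nat. (1/2::real)^(x div 2))"
proof -
  have bound: "(1/2::real)^(x div 2) \<le> (4/3) * (3/4)^x" for x
  proof -
    \<comment> \<open>Comparison with a geometric series in \<open>x\<close>: a rational square above \<open>1/2\<close> gives a rational ratio.\<close>
    have "(1/2::real)^(x div 2) \<le> (9/16)^(x div 2)"
      by (rule power_mono) simp_all
    also have "\<dots> = (3/4)^(2 * (x div 2))"
      by (simp add: power_mult power2_eq_square)
    also have "\<dots> \<le> (4/3) * (3/4)^x"
    proof -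
      have "(3/4::real)^1 \<le> (3/4)^(x mod 2)"
        by (rule power_decreasing) auto
      then have "(3/4)^(2 * (x div 2)) * 1 \<le> (3/4::real)^(2 * (x div 2)) * ((4/3) * (3/4)^(x mod 2))"
        by (intro mult_left_mono) auto
      also have "\<dots> = (4/3) * (3/4)^(2 * (x div 2) + x mod 2)"
        by (simp only: power_add mult.commute mult.left_commute)
      finally show ?thesis by simp
    qed
    finally show ?thesis .
  qed
  show ?thesis
  proof (rule summable_comparison_test')
    show "summable (\<lambda>x. (4/3) * (3/4::real)^x)"
      by (rule summable_mult[OF summable_geometric]) simp
    show "norm ((1/2::real)^(x div 2)) \<le> (4/3) * (3/4)^x" if "0 \<le> x" for x
      using bound[of x] by simp
  qed
qed

lemma amplitude_pos: "amplitude x > 0"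
  by (simp add: amplitude_def Let_def)

lemma weighted_amplitude: "pair_weight x * amplitude x = (1/2)^(x div 2)"
  by (simp add: pair_weight_def amplitude_def Let_def flip: power_mult_distrib)

lemma amplitude_ge_1: "amplitude x \<ge> 1"
  by (simp add: amplitude_def Let_def)

lemma summable_pair_weight: "summable pair_weight"
proof (rule summable_comparison_test'[OF summable_half_div2, of 0])
  fix x :: nat
  show "norm (pair_weight x) \<le> (1/2)^(x div 2)"
    using mult_left_mono[OF amplitude_ge_1[of x], of "pair_weight x"] pair_weight_pos[of x]
      weighted_amplitude[of x] by simp
qed

lemma refresh_weight_le: "pair_weight x * refresh_prob x \<le> pair_weight x"
  using mult_left_mono[OF refresh_prob_le_1[of x], of "pair_weight x"] pair_weight_pos[of x] by simp

lemma summable_refresh_weight: "summable (\<lambda>x. pair_weight x * refresh_prob x)"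
proof (rule summable_comparison_test'[OF summable_pair_weight, of 0])
  show "norm (pair_weight x * refresh_prob x) \<le> pair_weight x" for x
    using refresh_weight_le[of x] refresh_prob_pos[of x] pair_weight_pos[of x] by simp
qed

lemma pmf_stat_law: "pmf stat_law x = pair_weight x / suminf pair_weight"
  unfolding stat_law_def by (intro pmf_weight_pmf pair_weight_pos summable_pair_weight)

lemma pmf_refresh_law: "pmf refresh_law x = pair_weight x * refresh_prob x / (\<Sum>x. pair_weight x * refresh_prob x)"
  unfolding refresh_law_def
  by (intro pmf_weight_pmf mult_pos_pos pair_weight_pos refresh_prob_pos summable_refresh_weight)

lemma total_weight_pos: "suminf pair_weight > 0"
  by (intro suminf_pos summable_pair_weight pair_weight_pos)
lemma total_refresh_weight_pos: "(\<Sum>x. pair_weight x * refresh_prob x) > 0"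
  by (intro suminf_pos summable_refresh_weight mult_pos_pos pair_weight_pos refresh_prob_pos)

lemma pmf_refresh_law_pos: "pmf refresh_law x > 0"
  by (simp add: pmf_refresh_law pair_weight_pos refresh_prob_pos total_refresh_weight_pos)

lemma pmf_chain_kernel: "pmf (chain_kernel x) y = refresh_prob x * pmf refresh_law y + (if switch x = y then 1 - refresh_prob x else 0)"
  unfolding chain_kernel_def by (intro pmf_refresh_kernel refresh_prob_le_1 less_imp_le refresh_prob_pos)

lemma pmf_chain_kernel_pos: "pmf (chain_kernel x) y > 0"
  unfolding pmf_chain_kernel
  by (intro add_pos_nonneg mult_pos_pos refresh_prob_pos pmf_refresh_law_pos) (simp add: refresh_prob_le_1)

lemma reversible_chain_kernel: "reversible_kernel chain_kernel stat_law"
  unfolding chain_kernel_def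
  by (rule reversible_refresh_kernel[where K = "suminf pair_weight / (\<Sum>x. pair_weight x * refresh_prob x)"])
     (use total_weight_pos total_refresh_weight_pos in
       \<open>auto simp: refresh_prob_le_1 pmf_stat_law pmf_refresh_law less_imp_le[OF refresh_prob_pos]\<close>)

lemma nn_integral_abs_observable_finite:
  "(\<integral>\<^sup>+x. ennreal \<bar>observable x\<bar> \<partial>stat_law) < \<infinity>" "(\<integral>\<^sup>+x. ennreal \<bar>observable x\<bar> \<partial>refresh_law) < \<infinity>"
proof -
  let ?W = "suminf pair_weight" and ?V = "\<Sum>x. pair_weight x * refresh_prob x"
  show "(\<integral>\<^sup>+x. ennreal \<bar>observable x\<bar> \<partial>stat_law) < \<infinity>"
  proof (rule nn_integral_pmf_nat_finite)
    show "summable (\<lambda>x. (1/2)^(x div 2) / ?W)"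
      by (intro summable_divide summable_half_div2)
  qed (simp_all add: pmf_stat_law abs_observable amplitude_pos less_imp_le weighted_amplitude)
  show "(\<integral>\<^sup>+x. ennreal \<bar>observable x\<bar> \<partial>refresh_law) < \<infinity>"
  proof (rule nn_integral_pmf_nat_finite)
    show "summable (\<lambda>x. (1/2)^(x div 2) / ?V)"
      by (intro summable_divide summable_half_div2)
    show "pmf refresh_law x * \<bar>observable x\<bar> \<le> (1/2)^(x div 2) / ?V" for x
      using mult_right_mono[OF refresh_weight_le[of x], of "amplitude x"] amplitude_pos[of x] total_refresh_weight_pos
      by (auto simp: pmf_refresh_law abs_observable divide_le_cancel simp flip: weighted_amplitude)
  qed simp
qed

lemma integrable_observable: "integrable (measure_pmf stat_law) observable"
  using nn_integral_abs_observable_finite(1) by (intro integrableI_bounded) auto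

text \<open>
  Exchanging the two states of every pair preserves \<open>\<pi>\<close> and changes the sign of \<open>h\<close>.
\<close>

lemma expectation_observable: "measure_pmf.expectation stat_law observable = 0"
proof -
  have inj: "inj partner" by (metis injI partner_partner)
  have "map_pmf partner stat_law = stat_law"
  proof (rule pmf_eqI)
    show "pmf (map_pmf partner stat_law) x = pmf stat_law x" for x
      using pmf_map_inj'[OF inj, of stat_law "partner x"] by (simp add: pmf_stat_law)
  qed
  then have "measure_pmf.expectation stat_law observable = measure_pmf.expectation (map_pmf partner stat_law) observable"
    by simp
  also have "\<dots> = - measure_pmf.expectation stat_law observable"
    by (simp del: Bochner_Integration.integral_minus add: Bochner_Integration.integral_minus[symmetric])
  finally show ?thesis by simp
qed

section \<open>Holding probabilities and the finite integrals\<close>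

lemma hold_prob_chain_kernel:
  "hold_prob chain_kernel x =
     refresh_prob x * pmf refresh_law x + (if even (x div 2) then 0 else 1 - refresh_prob x)"
  by (simp add: hold_prob_def pmf_chain_kernel switch_def)

lemma stat_law_second_moment_even:
  assumes "even (x div 2)"
  shows "pmf stat_law x * (observable x)\<^sup>2 = 1 / suminf pair_weight"
proof -
  have "pair_weight x * (amplitude x)\<^sup>2 = 1"
    using assms
    by (simp add: pair_weight_def amplitude_def Let_def power_divide flip: power_mult_distrib)
       (simp add: power2_eq_square flip: power_mult_distrib)
  moreover have "(observable x)\<^sup>2 = (amplitude x)\<^sup>2"
    by (simp add: observable_def)
  ultimately show ?thesis
    by (simp add: pmf_stat_law)
qed

lemma observable_sq_odd:
  assumes "odd (x div 2)"
  shows "(observable x)\<^sup>2 = 1"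
  using assms by (simp add: observable_def amplitude_def Let_def)

text \<open>
  Since \<open>r \<le> 1\<close>, only \<open>n = 1\<close> matters. On switching pairs \<open>\<pi> h\<^sup>2\<close> is a constant and \<open>r \<le> \<nu>\<close>; on holding
  pairs \<open>h\<^sup>2 = 1\<close> and \<open>\<pi>\<close> itself is summable.
\<close>

lemma nn_integral_hold_finite:
  assumes "n \<ge> 1"
  shows "(\<integral>\<^sup>+x. ennreal ((observable x)\<^sup>2 * hold_prob chain_kernel x ^ n) \<partial>stat_law) < \<infinity>"
proof (rule nn_integral_pmf_nat_finite)
  let ?W = "suminf pair_weight" and ?V = "\<Sum>x. pair_weight x * refresh_prob x"
  let ?r = "hold_prob chain_kernel"
  show "summable (\<lambda>x. pair_weight x * refresh_prob x / ?V / ?W + pair_weight x / ?W)"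
    by (intro summable_add summable_divide summable_refresh_weight summable_pair_weight)
  fix x
  have r: "0 \<le> ?r x" "?r x \<le> 1" by (simp_all add: hold_prob_def pmf_le_1)
  have rn: "?r x ^ n \<le> ?r x" using power_decreasing[OF assms r] by simp
  show "0 \<le> (observable x)\<^sup>2 * ?r x ^ n" using r by simp
  have nn: "0 \<le> pair_weight x * refresh_prob x / ?V / ?W" "0 \<le> pair_weight x / ?W"
    using pair_weight_pos[of x] refresh_prob_pos[of x] total_weight_pos total_refresh_weight_pos by simp_all
  have "pmf stat_law x * ((observable x)\<^sup>2 * ?r x ^ n) \<le> pmf stat_law x * (observable x)\<^sup>2 * ?r x"
    using rn by (simp add: mult.assoc mult_left_mono)
  also have "\<dots> \<le> pair_weight x * refresh_prob x / ?V / ?W + pair_weight x / ?W"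
  proof (cases "even (x div 2)")
    case True
    have "?r x \<le> pmf refresh_law x"
      using True mult_right_mono[OF refresh_prob_le_1[of x], of "pmf refresh_law x"]
      by (simp add: hold_prob_chain_kernel)
    then have "?r x / ?W \<le> pmf refresh_law x / ?W"
      using total_weight_pos by (intro divide_right_mono) auto
    then show ?thesis
      using True nn by (simp add: stat_law_second_moment_even pmf_refresh_law)
  next
    case False
    then have "pmf stat_law x * (observable x)\<^sup>2 * ?r x \<le> pair_weight x / ?W"
      using mult_left_mono[OF r(2) pmf_nonneg, of stat_law x] by (simp add: observable_sq_odd pmf_stat_law)
    then show ?thesis using nn by simp
  qed
  finally show "pmf stat_law x * ((observable x)\<^sup>2 * ?r x ^ n) \<le>
      pair_weight x * refresh_prob x / ?V / ?W + pair_weight x / ?W" .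
qed

text \<open>
  A single holding state \<open>x\<close> suffices, chosen with \<open>d(x)\<close> of order \<open>1/n\<close> and at most \<open>1/(2n)\<close>: Bernoulli's inequality
  gives \<open>r(x)\<^sup>n \<ge> 1 - n d(x) \<ge> 1/2\<close>, and \<open>\<pi>(x)\<close>, which is proportional to the square root of \<open>d(x)\<close>, is
  then at least of order \<open>1/sqrt n\<close>.
\<close>

lemma nn_integral_hold_lower_bound:
  assumes "n \<ge> 1"
  shows "ennreal (sqrt (real n) / (16 * suminf pair_weight)) \<le>
    of_nat n * (\<integral>\<^sup>+x. ennreal ((observable x)\<^sup>2 * hold_prob chain_kernel x ^ n) \<partial>stat_law)"
proof -
  let ?W = "suminf pair_weight" and ?r = "hold_prob chain_kernel"
  obtain k where k: "16 ^ k \<le> n" "n < 16 ^ (k + 1)"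
    using ex_power_ivl1[of 16 n] assms by auto
  \<comment> \<open>Odd, so that the pair is holding; \<open>2k + 2\<close> is the exponent of 4 in the upper bound for \<open>n\<close>, and one
    more makes \<open>n d < 1/4\<close>.\<close>
  define j where "j = 2 * k + 3"
  define x where "x = 2 * j"
  have x: "odd (x div 2)" "x div 2 = j" by (simp_all add: x_def j_def)
  define d where "d = refresh_prob x"
  have d: "d = (1/4)^j" using x by (simp add: d_def refresh_prob_def)
  have d01: "0 \<le> d" "d \<le> 1" by (simp_all add: d power_le_one)
  have nd: "real n * d \<le> 1/2"
  proof -
    have "real n \<le> 16 ^ (k + 1)" using k(2) by (metis less_imp_le of_nat_le_iff of_nat_numeral of_nat_power)
    then have "real n * d \<le> 16 ^ (k + 1) * d" using d01 by (intro mult_right_mono)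
    also have "\<dots> = 1/4"
      by (simp add: d j_def power_add power_mult power_divide power2_eq_square power3_eq_cube)
    finally show ?thesis by simp
  qed
  have "1/2 \<le> 1 + real n * (- d)" using nd by simp
  also have "\<dots> \<le> (1 + (- d)) ^ n" using d01 by (intro Bernoulli_inequality) simp
  also have "\<dots> \<le> ?r x ^ n"
    using d01 x by (intro power_mono) (auto simp: hold_prob_chain_kernel d_def)
  finally have r: "1/2 \<le> ?r x ^ n" .
  have w: "sqrt (real n) \<le> 8 * (real n * pair_weight x)"
  proof -
    have "(16::real) ^ k \<le> real n"
      using k(1) by (metis of_nat_le_iff of_nat_numeral of_nat_power)
    then have "(4 ^ k)\<^sup>2 \<le> real n"
      by (simp add: power2_eq_square flip: power_mult_distrib)
    then have "4 ^ k \<le> sqrt (real n)" by (rule real_le_rsqrt)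
    then have "sqrt (real n) * 4 ^ k \<le> sqrt (real n) * sqrt (real n)"
      by (rule mult_left_mono) simp
    then have "sqrt (real n) \<le> real n / 4 ^ k"
      by (simp add: pos_le_divide_eq)
    moreover have "pair_weight x = 1 / (8 * 4 ^ k)"
      using x by (simp add: pair_weight_def j_def power_add power_mult power_divide power2_eq_square power3_eq_cube)
    ultimately show ?thesis by simp
  qed
  have "sqrt (real n) / (16 * ?W) \<le> real n * (pmf stat_law x * ((observable x)\<^sup>2 * ?r x ^ n))"
  proof -
    have "sqrt (real n) / (16 * ?W) \<le> 8 * (real n * pair_weight x) / (16 * ?W)"
      using w total_weight_pos by (intro divide_right_mono) auto
    also have "\<dots> = real n * pmf stat_law x * (1/2)" by (simp add: pmf_stat_law)
    also have "\<dots> \<le> real n * pmf stat_law x * ?r x ^ n"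
      using r by (intro mult_left_mono) auto
    finally show ?thesis using x by (simp add: observable_sq_odd mult.assoc)
  qed
  then have "ennreal (sqrt (real n) / (16 * ?W)) \<le>
      ennreal (real n * (pmf stat_law x * ((observable x)\<^sup>2 * ?r x ^ n)))"
    by (rule ennreal_leI)
  also have "\<dots> = of_nat n * (ennreal (pmf stat_law x) * ennreal ((observable x)\<^sup>2 * ?r x ^ n))"
    by (simp add: ennreal_mult' ennreal_of_nat_eq_real_of_nat)
  also have "\<dots> \<le> of_nat n * (\<integral>\<^sup>+x. ennreal ((observable x)\<^sup>2 * ?r x ^ n) \<partial>stat_law)"
    unfolding nn_integral_measure_pmf
    by (intro mult_left_mono nn_integral_ge_point) auto
  finally show ?thesis .
qed

lemma hold_moment_tendsto_top:
  "(\<lambda>n. of_nat n * (\<integral>\<^sup>+x. ennreal ((observable x)\<^sup>2 * hold_prob chain_kernel x ^ n) \<partial>stat_law))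
     \<longlonglongrightarrow> \<infinity>"
proof -
  have "filterlim (\<lambda>n. sqrt (real n)) at_top sequentially"
    by (rule filterlim_compose[OF sqrt_at_top filterlim_real_sequentially])
  then have "filterlim (\<lambda>n. sqrt (real n) * (1 / (16 * suminf pair_weight))) at_top sequentially"
    using total_weight_pos by (intro filterlim_at_top_mult_tendsto_pos[OF tendsto_const]) auto
  then have "(\<lambda>n. ennreal (sqrt (real n) / (16 * suminf pair_weight))) \<longlonglongrightarrow> top"
    by (simp add: ennreal_tendsto_top_eq_at_top)
  then show ?thesis
    unfolding infinity_ennreal_def
    by (rule tendsto_sandwich[OF _ _ _ tendsto_const, rotated 2])
       (auto intro!: eventually_sequentiallyI[of 1] nn_integral_hold_lower_bound)
qed

text \<open>
  After a refresh, \<open>X\<^sub>1\<close> has the law \<open>\<nu>\<close> whatever \<open>X\<^sub>0\<close> is, so the positive part of the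
  product has expectation at most \<open>\<pi>(\<bar>h\<bar>) \<nu>(\<bar>h\<bar>)\<close>. Without a refresh the product is negative on switching pairs and 1 on holding pairs.
\<close>

lemma nn_integral_positive_product_finite:
  "(\<integral>\<^sup>+x. \<integral>\<^sup>+y. ennreal (observable x * observable y) \<partial>chain_kernel x \<partial>stat_law) < \<infinity>"
proof -
  define K where "K = (\<integral>\<^sup>+y. ennreal \<bar>observable y\<bar> \<partial>refresh_law)"
  have "(\<integral>\<^sup>+y. ennreal (observable x * observable y) \<partial>chain_kernel x) \<le> ennreal \<bar>observable x\<bar> * K + 1" for x
  proof -
    have "(\<integral>\<^sup>+y. ennreal (observable x * observable y) \<partial>chain_kernel x) =
        (\<integral>\<^sup>+y. ennreal (observable x * observable y) \<partial>refresh_law) * refresh_prob x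
          + ennreal (observable x * observable (switch x)) * (1 - refresh_prob x)"
      unfolding chain_kernel_def
      by (intro nn_integral_refresh_kernel refresh_prob_le_1 less_imp_le[OF refresh_prob_pos])
    also have "\<dots> \<le> (\<integral>\<^sup>+y. ennreal (observable x * observable y) \<partial>refresh_law) * 1 + 1 * 1"
    proof (rule add_mono)
      show "(\<integral>\<^sup>+y. ennreal (observable x * observable y) \<partial>refresh_law) * refresh_prob x \<le>
          (\<integral>\<^sup>+y. ennreal (observable x * observable y) \<partial>refresh_law) * 1"
        using refresh_prob_le_1[of x] by (intro mult_left_mono) (simp_all add: ennreal_le_1)
      have "observable x * observable (switch x) \<le> 1"
      proof (cases "even (x div 2)")
        case True
        then have "observable x * observable (switch x) = - (observable x * observable x)"
          by (simp add: switch_def)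
        then show ?thesis using zero_le_square[of "observable x"] by linarith
      next
        case False
        then show ?thesis using observable_sq_odd[of x] by (simp add: switch_def power2_eq_square)
      qed
      then show "ennreal (observable x * observable (switch x)) * ennreal (1 - refresh_prob x) \<le> 1 * 1"
        using refresh_prob_pos[of x] by (intro mult_mono) (simp_all add: ennreal_le_1)
    qed
    also have "\<dots> \<le> ennreal \<bar>observable x\<bar> * K + 1"
    proof -
      have "(\<integral>\<^sup>+y. ennreal (observable x * observable y) \<partial>refresh_law) \<le>
          (\<integral>\<^sup>+y. ennreal \<bar>observable x\<bar> * ennreal \<bar>observable y\<bar> \<partial>refresh_law)"
      proof (rule nn_integral_mono)
        fix y
        have "observable x * observable y \<le> \<bar>observable x\<bar> * \<bar>observable y\<bar>"
          unfolding abs_mult[symmetric] by (rule abs_ge_self)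
        then show "ennreal (observable x * observable y) \<le> ennreal \<bar>observable x\<bar> * ennreal \<bar>observable y\<bar>"
          unfolding ennreal_mult'[OF abs_ge_zero, symmetric] by (rule ennreal_leI)
      qed
      also have "\<dots> = ennreal \<bar>observable x\<bar> * K"
        by (simp add: nn_integral_cmult K_def)
      finally show ?thesis by (simp add: add_right_mono)
    qed
    finally show ?thesis .
  qed
  then have "(\<integral>\<^sup>+x. \<integral>\<^sup>+y. ennreal (observable x * observable y) \<partial>chain_kernel x \<partial>stat_law) \<le>
      (\<integral>\<^sup>+x. ennreal \<bar>observable x\<bar> * K + 1 \<partial>stat_law)"
    by (rule nn_integral_mono)
  also have "\<dots> = (\<integral>\<^sup>+x. ennreal \<bar>observable x\<bar> \<partial>stat_law) * K + 1"
    by (simp add: nn_integral_add nn_integral_multc)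
  also have "\<dots> < \<infinity>"
    using nn_integral_abs_observable_finite by (simp add: K_def ennreal_mult_less_top less_top)
  finally show ?thesis .
qed

section \<open>Infinite autocovariances and infinite variance\<close>

lemma infinite_switching_states: "infinite {x. even x \<and> even (x div 2) \<and> b \<le> observable x}"
proof -
  obtain k0 where k0: "b < 4 ^ k0"
    using real_arch_pow[of 4 b] by auto
  have "(\<lambda>k. 4 * k) ` {k0..} \<subseteq> {x. even x \<and> even (x div 2) \<and> b \<le> observable x}"
  proof safe
    fix k assume "k0 \<le> k"
    have "observable (4 * k) = 4 ^ k"
      by (simp add: observable_def amplitude_def power_mult)
    moreover have "(4::real) ^ k0 \<le> 4 ^ k"
      using \<open>k0 \<le> k\<close> by (intro power_increasing) auto
    ultimately show "b \<le> observable (4 * k)"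
      using k0 by linarith
  qed auto
  moreover have "infinite ((\<lambda>k::nat. 4 * k) ` {k0..})"
    by (subst finite_image_iff) (auto simp: inj_on_def infinite_Ici)
  ultimately show ?thesis by (rule infinite_super)
qed

context
  fixes M :: "'w measure" and X :: "nat \<Rightarrow> 'w \<Rightarrow> nat"
  assumes mc: "markov_chain M X chain_kernel stat_law"
begin

lemma nn_integral_observable_sq:
  "(\<integral>\<^sup>+\<omega>. ennreal (observable (X 0 \<omega>) * observable (X 0 \<omega>)) \<partial>M) = \<infinity>"
proof (rule nn_integral_markov_eq_top[OF mc infinite_switching_states[of 0], where n = 0
      and traj = "\<lambda>x _. x" and v = "\<lambda>x. (observable x)\<^sup>2"])
  show "0 < 1 / suminf pair_weight" using total_weight_pos by simp
  show "1 / suminf pair_weight \<le> (observable x)\<^sup>2 *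
      (pmf stat_law x * (\<Prod>i<(0::nat). pmf (chain_kernel x) x))"
    if "x \<in> {x. even x \<and> even (x div 2) \<and> 0 \<le> observable x}" for x
    using that stat_law_second_moment_even[of x] by (simp add: mult.commute)
qed (auto simp: power2_eq_square)

text \<open>
  From a switching state \<open>x\<close> the chain moves to the partner of \<open>x\<close> with probability at least 1/2, and
  then \<open>h(X\<^sub>0) h(X\<^sub>1) = -h(x)\<^sup>2\<close>.
\<close>

lemma nn_integral_negative_product:
  "(\<integral>\<^sup>+\<omega>. ennreal (- (observable (X 0 \<omega>) * observable (X 1 \<omega>))) \<partial>M) = \<infinity>"
proof (rule nn_integral_markov_eq_top[OF mc infinite_switching_states[of 0], where n = 1
      and traj = "\<lambda>x i. if i = 0 then x else partner x" and v = "\<lambda>x. (observable x)\<^sup>2"])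
  show "0 < 1 / suminf pair_weight * (1/2)" using total_weight_pos by simp
  fix x assume x: "x \<in> {x. even x \<and> even (x div 2) \<and> 0 \<le> observable x}"
  have "1/2 \<le> pmf (chain_kernel x) (partner x)"
    using x by (simp add: pmf_chain_kernel switch_def refresh_prob_def)
  then have "1 / suminf pair_weight * (1/2) \<le> 1 / suminf pair_weight * pmf (chain_kernel x) (partner x)"
    by (rule mult_left_mono) (use total_weight_pos in simp)
  then have "1 / suminf pair_weight * (1/2) \<le>
      pmf stat_law x * (observable x)\<^sup>2 * pmf (chain_kernel x) (partner x)"
    using x by (subst stat_law_second_moment_even) auto
  then show "1 / suminf pair_weight * (1/2) \<le> (observable x)\<^sup>2 *
      (pmf stat_law x * (\<Prod>i<1. pmf (chain_kernel (if i = 0 then x else partner x))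
        (if Suc i = 0 then x else partner x)))"
    by (simp add: mult_ac)
  show "(observable x)\<^sup>2 \<le> - (observable (X 0 \<omega>) * observable (X 1 \<omega>))"
    if "\<And>i. i \<le> 1 \<Longrightarrow> X i \<omega> = (if i = 0 then x else partner x)" for \<omega>
    using that[of 0] that[of 1] by (simp add: power2_eq_square)
qed auto

text \<open>
  The trajectories \<open>x, 0, 0, \<dots>, 0\<close> are used. Along them the centred sum is \<open>h(x) + C\<close> with \<open>C\<close> independent
  of \<open>x\<close>, hence at least \<open>h(x) / 2\<close> as soon as \<open>h(x) \<ge> 2 \<bar>C\<bar>\<close>, and their probability is at least
  \<open>\<alpha> \<pi>(x)\<close>. They have one step more than the sum needs, so that \<open>m = 0\<close> requires no separate argument.
\<close>

lemma ext_variance_partial_sum: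
  "ext_variance M (partial_sum X observable (Suc m)) = \<infinity>"
proof -
  define \<mu> where "\<mu> = integral\<^sup>L M (partial_sum X observable (Suc m))"
  define C where "C = real m * observable 0 - \<mu>"
  define \<alpha> where "\<alpha> = (1/2) * pmf refresh_law 0 * pmf (chain_kernel 0) 0 ^ m"
  have \<alpha>: "0 < \<alpha>"
    by (simp add: \<alpha>_def pmf_refresh_law_pos pmf_chain_kernel_pos)
  have "(\<integral>\<^sup>+\<omega>. ennreal ((partial_sum X observable (Suc m) \<omega> - \<mu>)\<^sup>2) \<partial>M) = \<infinity>"
  proof (rule nn_integral_markov_eq_top[OF mc infinite_switching_states[of "2 * \<bar>C\<bar>"], where n = "Suc m"
      and traj = "\<lambda>x i. if i = 0 then x else 0" and v = "\<lambda>x. (observable x / 2)\<^sup>2"])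
    show "0 < 1 / suminf pair_weight * \<alpha> / 4"
      using total_weight_pos \<alpha> by simp
    fix x assume x: "x \<in> {x. even x \<and> even (x div 2) \<and> 2 * \<bar>C\<bar> \<le> observable x}"
    have prod: "(\<Prod>i<Suc m. pmf (chain_kernel (if i = 0 then x else 0)) (if Suc i = 0 then x else 0)) =
        pmf (chain_kernel x) 0 * pmf (chain_kernel 0) 0 ^ m"
      by (simp add: prod.lessThan_Suc_shift del: prod.lessThan_Suc)
    have "(1/2) * pmf refresh_law 0 \<le> pmf (chain_kernel x) 0"
      using x by (simp add: pmf_chain_kernel refresh_prob_def)
    then have "\<alpha> \<le> pmf (chain_kernel x) 0 * pmf (chain_kernel 0) 0 ^ m"
      unfolding \<alpha>_def by (rule mult_right_mono) simp
    then have "1 / suminf pair_weight * \<alpha> \<le>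
        1 / suminf pair_weight * (pmf (chain_kernel x) 0 * pmf (chain_kernel 0) 0 ^ m)"
      by (rule mult_left_mono) (use total_weight_pos in simp)
    then have "1 / suminf pair_weight * \<alpha> \<le>
        pmf stat_law x * (observable x)\<^sup>2 * (pmf (chain_kernel x) 0 * pmf (chain_kernel 0) 0 ^ m)"
      using x by (subst stat_law_second_moment_even) auto
    then show "1 / suminf pair_weight * \<alpha> / 4 \<le> (observable x / 2)\<^sup>2 * (pmf stat_law x *
        (\<Prod>i<Suc m. pmf (chain_kernel (if i = 0 then x else 0)) (if Suc i = 0 then x else 0)))"
      unfolding prod by (simp add: power_divide mult_ac)
    show "(observable x / 2)\<^sup>2 \<le> (partial_sum X observable (Suc m) \<omega> - \<mu>)\<^sup>2"
      if "\<And>i. i \<le> Suc m \<Longrightarrow> X i \<omega> = (if i = 0 then x else 0)" for \<omega>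
    proof -
      have "partial_sum X observable (Suc m) \<omega> = (\<Sum>k<Suc m. observable (if k = 0 then x else 0))"
        unfolding partial_sum_def using that by (intro sum.cong) auto
      also have "\<dots> = observable x + real m * observable 0"
        by (simp add: sum.lessThan_Suc_shift del: sum.lessThan_Suc)
      finally have "partial_sum X observable (Suc m) \<omega> - \<mu> = observable x + C"
        by (simp add: C_def)
      then show ?thesis
        using x by (intro power_mono) auto
    qed
  qed auto
  then show ?thesis by (simp add: ext_variance_def \<mu>_def)
qed

lemma has_asymptotic_variance_top: "has_asymptotic_variance M X observable \<infinity>"
proof -
  have "ext_variance M (partial_sum X observable n) / of_nat n = \<infinity>" if "n \<ge> 1" for n
  proof -
    obtain m where "n = Suc m" using \<open>n \<ge> 1\<close> by (cases n) auto
    then show ?thesis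
      by (simp only: ext_variance_partial_sum) (simp add: ennreal_top_divide)
  qed
  then show ?thesis
    unfolding has_asymptotic_variance_def
    by (intro tendsto_eventually eventually_sequentiallyI[of 1])
qed

lemma autocov_0: "autocov M X observable 0 = Some \<infinity>"
  using nn_integral_observable_sq
  by (simp add: autocov_def ext_expectation_def Let_def ennreal_neg)

lemma autocov_1: "autocov M X observable 1 = Some (-\<infinity>)"
proof -
  have "(\<integral>\<^sup>+\<omega>. ennreal (observable (X 0 \<omega>) * observable (X 1 \<omega>)) \<partial>M) < \<infinity>"
    using nn_integral_positive_product_finite
    by (subst nn_integral_markov_step[OF mc, where F = "\<lambda>x y. ennreal (observable x * observable y)"])
  then obtain r where "(\<integral>\<^sup>+\<omega>. ennreal (observable (X 0 \<omega>) * observable (X 1 \<omega>)) \<partial>M) = ennreal r" "0 \<le> r"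
    by (metis ennreal_cases less_irrefl infinity_ennreal_def)
  then show ?thesis
    using nn_integral_negative_product by (simp add: autocov_def ext_expectation_def Let_def)
qed

lemma autocov_sum_undefined: "m \<ge> 1 \<Longrightarrow> autocov_sum M X observable m = None"
  using autocov_0 autocov_1 unfolding autocov_sum_def by auto

lemma no_autocov_series: "\<not> has_autocov_series M X observable b"
proof
  assume "has_autocov_series M X observable b"
  then have "\<forall>\<^sub>F m in sequentially. autocov_sum M X observable m \<noteq> None"
    by (simp add: has_autocov_series_def)
  then have "\<forall>\<^sub>F m in sequentially. False"
    using eventually_ge_at_top[of "1::nat"] by eventually_elim (use autocov_sum_undefined in auto)
  then show False by simp
qed

end

theorem theorem4p5:
  "\<exists>(P :: nat \<Rightarrow> nat pmf) (p :: nat pmf) (h :: nat \<Rightarrow> real)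
     (M :: (nat \<Rightarrow> nat) measure) (X :: nat \<Rightarrow> (nat \<Rightarrow> nat) \<Rightarrow> nat).
     irreducible_kernel P \<and> aperiodic_kernel P \<and>
     stationary_dist P p \<and> reversible_kernel P p \<and>
     integrable (measure_pmf p) h \<and>
     \<not> integrable (measure_pmf p) (\<lambda>x. (h x)\<^sup>2) \<and>
     measure_pmf.expectation p h = 0 \<and>
     markov_chain M X P p \<and>
     (\<forall>n\<ge>1. (\<integral>\<^sup>+ \<omega>. ennreal ((h (X 0 \<omega>))\<^sup>2 * hold_prob P (X 0 \<omega>) ^ n) \<partial>M) < \<infinity>) \<and>
     (\<lambda>n. of_nat n * (\<integral>\<^sup>+ \<omega>. ennreal ((h (X 0 \<omega>))\<^sup>2 * hold_prob P (X 0 \<omega>) ^ n) \<partial>M))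
       \<longlonglongrightarrow> \<infinity> \<and>
     has_asymptotic_variance M X h \<infinity> \<and>
     autocov M X h 1 = Some (-\<infinity>) \<and>
     (\<integral>\<^sup>+ x. ennreal ((h x)\<^sup>2) \<partial>measure_pmf p) = \<infinity> \<and>
     autocov M X h 0 = Some \<infinity> \<and>
     (\<forall>m\<ge>1. autocov_sum M X h m = None) \<and>
     (\<nexists>b. has_autocov_series M X h b)"
proof -
  define M where "M = chain_construction.path_space chain_kernel stat_law"
  let ?X = "\<lambda>n (\<omega> :: nat \<Rightarrow> nat). \<omega> n"
  have mc: "markov_chain M ?X chain_kernel stat_law"
    unfolding M_def by (rule chain_construction.markov_chain_path_space)
  have start: "(\<integral>\<^sup>+\<omega>. f (\<omega> 0) \<partial>M) = (\<integral>\<^sup>+x. f x \<partial>stat_law)" for f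
    by (rule nn_integral_markov_start[OF mc])
  have hold: "(\<integral>\<^sup>+\<omega>. ennreal ((observable (?X 0 \<omega>))\<^sup>2 * hold_prob chain_kernel (?X 0 \<omega>) ^ n) \<partial>M) =
      (\<integral>\<^sup>+x. ennreal ((observable x)\<^sup>2 * hold_prob chain_kernel x ^ n) \<partial>stat_law)" for n
    by (rule start)
  have sq: "(\<integral>\<^sup>+x. ennreal ((observable x)\<^sup>2) \<partial>stat_law) = \<infinity>"
    using nn_integral_observable_sq[OF mc] start[of "\<lambda>x. ennreal (observable x * observable x)"]
    by (simp add: power2_eq_square)
  then have "\<not> integrable (measure_pmf stat_law) (\<lambda>x. (observable x)\<^sup>2)"
    by (auto simp: integrable_iff_bounded)
  moreover have "irreducible_kernel chain_kernel" "aperiodic_kernel chain_kernel"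
    using positive_kernel_irreducible_aperiodic[of chain_kernel] pmf_chain_kernel_pos by blast+
  moreover have "stationary_dist chain_kernel stat_law"
    by (rule reversible_imp_stationary[OF reversible_chain_kernel])
  moreover note sq mc reversible_chain_kernel integrable_observable expectation_observable
    has_asymptotic_variance_top[OF mc] autocov_0[OF mc] autocov_1[OF mc]
  moreover have "\<forall>n\<ge>1. (\<integral>\<^sup>+\<omega>. ennreal ((observable (?X 0 \<omega>))\<^sup>2 * hold_prob chain_kernel (?X 0 \<omega>) ^ n) \<partial>M) < \<infinity>"
    unfolding hold using nn_integral_hold_finite by blast
  moreover have "(\<lambda>n. of_nat n * (\<integral>\<^sup>+\<omega>. ennreal ((observable (?X 0 \<omega>))\<^sup>2 * hold_prob chain_kernel (?X 0 \<omega>) ^ n) \<partial>M))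
      \<longlonglongrightarrow> \<infinity>"
    unfolding hold by (rule hold_moment_tendsto_top)
  moreover have "\<forall>m\<ge>1. autocov_sum M ?X observable m = None"
    using autocov_sum_undefined[OF mc] by blast
  moreover have "\<nexists>b. has_autocov_series M ?X observable b"
    using no_autocov_series[OF mc] by blast
  ultimately show ?thesis by blast
qed

end
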